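(* Let $l,J\in\mathbb Z$ and consider the irreducible complex representations $\rho_l,\rho_J$ of $\mathrm U(1)\cong\mathrm{SO}(2)$ on $V_l=V_J=\mathbb C$. A basis of the space of $\mathrm U(1)$-steerable kernels $K:S^1\to\mathrm{Hom}_{\mathbb C}(V_l,V_J)$, written as $1\times1$ matrices, is given by the single function $Y_{l-J}:S^1\to\mathbb C$.
   Context: $\mathrm U(1)=\{g\in\mathbb C:|g|=1\}$, identified with $\mathrm{SO}(2)$, acts on $S^1=\{z\in\mathbb C:|z|=1\}$ by multiplication. For $l\in\mathbb Z$, $\rho_l:\mathrm U(1)\to\mathrm U(V_l)$ with $V_l=\mathbb C$ is given by $\rho_l(g)(z)=g^l z$; and $Y_l:S^1\to\mathbb C$ is given by $Y_l(z)=z^{-l}$. A steerable kernel is any function $K:S^1\to\mathrm{Hom}_{\mathbb C}(V_l,V_J)\cong\mathbb C$ with $K(gz)=\rho_J(g)\circ K(z)\circ\rho_l(g)^{-1}$ for all $g\in\mathrm U(1),z\in S^1$. *)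

theory Defs
  imports "HOL-Analysis.Analysis" "HOL-Library.Function_Algebras"
begin

text \<open>The circle is used both as the group U(1) and as the space it acts on;
  the action is the multiplication of this type.\<close>

typedef circle = "{z :: complex. cmod z = 1}"
  morphisms of_circle to_circle
  by (rule exI[of _ 1]) simp

setup_lifting type_definition_circle

instantiation circle :: comm_monoid_mult
begin

lift_definition one_circle :: circle is 1
  by simp

lift_definition times_circle :: "circle \<Rightarrow> circle \<Rightarrow> circle" is "(*)"
  by (simp add: norm_mult)

instance
  by standard (transfer; simp add: mult_ac)+

end

definition rho :: "int \<Rightarrow> circle \<Rightarrow> complex \<Rightarrow> complex" where
  "rho l g v = (of_circle g powi l) * v"

lemma rho_one: "rho l 1 = id"
  by (simp add: fun_eq_iff rho_def one_circle.rep_eq)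

lemma rho_mult: "rho l (g * h) = rho l g \<circ> rho l h"
  by (simp add: fun_eq_iff rho_def times_circle.rep_eq power_int_mult_distrib)

lemma linear_rho: "Vector_Spaces.linear (*) (*) (rho l g)"
  by unfold_locales (simp_all add: rho_def algebra_simps)

lemma norm_rho: "cmod (rho l g v) = cmod v"
  using of_circle[of g] by (simp add: rho_def norm_mult norm_power_int)

lemma bij_rho: "bij (rho l g)"
proof (rule o_bij)
  have "of_circle g \<noteq> 0"
    using of_circle[of g] by auto
  then show "(\<lambda>v. (of_circle g powi (- l)) * v) \<circ> rho l g = id"
    and "rho l g \<circ> (\<lambda>v. (of_circle g powi (- l)) * v) = id"
    by (simp_all add: fun_eq_iff rho_def power_int_minus)
qed

definition Y :: "int \<Rightarrow> circle \<Rightarrow> complex" where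
  "Y l z = of_circle z powi (- l)"

text \<open>Kernels take values in the complex-linear maps from \<open>V\<^sub>l\<close> to \<open>V\<^sub>J\<close>
  (both the complex numbers); no continuity or measurability is required.
  In \<open>steerable\<close>, \<open>inv\<close> is the inverse of the bijection \<open>rho l g\<close>.\<close>

definition steerable :: "int \<Rightarrow> int \<Rightarrow> (circle \<Rightarrow> complex \<Rightarrow> complex) \<Rightarrow> bool" where
  "steerable l J K \<longleftrightarrow>
     (\<forall>z. Vector_Spaces.linear (*) (*) (K z)) \<and>
     (\<forall>g z. K (g * z) = rho J g \<circ> K z \<circ> inv (rho l g))"

definition steerable_kernels :: "int \<Rightarrow> int \<Rightarrow> (circle \<Rightarrow> complex \<Rightarrow> complex) set" where
  "steerable_kernels l J = {K. steerable l J K}"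

definition kernel_scale ::
    "complex \<Rightarrow> (circle \<Rightarrow> complex \<Rightarrow> complex) \<Rightarrow> (circle \<Rightarrow> complex \<Rightarrow> complex)" where
  "kernel_scale c K = (\<lambda>z v. c * K z v)"

text \<open>Addition of kernels is the pointwise one of \<open>Function_Algebras\<close>.\<close>

interpretation kernel: vector_space kernel_scale
  by unfold_locales (simp_all add: kernel_scale_def fun_eq_iff algebra_simps)

text \<open>The linear map of a 1-by-1 matrix, with the complex numbers identified
  with \<open>complex^1\<close>.\<close>

definition hom_of_matrix :: "complex^1^1 \<Rightarrow> complex \<Rightarrow> complex" where
  "hom_of_matrix M v = (M *v (\<chi> i. v)) $ 1"

lemma bij_betw_hom_of_matrix:
  "bij_betw hom_of_matrix UNIV {f. Vector_Spaces.linear (*) (*) f}"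
proof (rule bij_betw_imageI)
  have hom: "hom_of_matrix M v = M $ 1 $ 1 * v" for M v
    by (simp add: hom_of_matrix_def matrix_vector_mult_def)
  show "inj hom_of_matrix"
  proof (rule injI)
    fix M N assume "hom_of_matrix M = hom_of_matrix N"
    then have "hom_of_matrix M 1 = hom_of_matrix N 1" by simp
    then show "M = N" by (simp add: hom vec_eq_iff forall_1)
  qed
  show "range hom_of_matrix = {f. Vector_Spaces.linear (*) (*) f}"
  proof (intro equalityI subsetI)
    fix f assume "f \<in> range hom_of_matrix"
    then obtain M where "f = hom_of_matrix M" by blast
    then show "f \<in> {f. Vector_Spaces.linear (*) (*) f}"
      by simp (unfold_locales; simp add: hom algebra_simps)
  next
    fix f :: "complex \<Rightarrow> complex"
    assume "f \<in> {f. Vector_Spaces.linear (*) (*) f}"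
    then have "f (c * 1) = c * f 1" for c
      by (simp only: mem_Collect_eq Vector_Spaces.linear_def module_hom_def module_hom_axioms_def)
    then have "f v = hom_of_matrix (\<chi> i j. f 1) v" for v
      by (metis hom mult.commute mult.right_neutral vec_lambda_beta)
    then have "f = hom_of_matrix (\<chi> i j. f 1)" by (rule ext)
    then show "f \<in> range hom_of_matrix" by blast
  qed
qed

end

theory Submission
  imports Defs
begin

text \<open>Steerability at the base point 1 forces
  \<open>K z = rho J z \<circ> K 1 \<circ> inv (rho l z)\<close>. All three factors are
  multiplications by scalars, so they commute and \<open>K z\<close> is multiplication by
  \<open>c * Y (l - J) z\<close> with \<open>c = K 1 1\<close>. Conversely, every such kernel is
  steerable because \<open>z powi n\<close> is multiplicative in \<open>z\<close>. Thus
  \<open>steerable_iff\<close> exhibits the kernels as the line through \<open>Y (l - J)\<close>,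
  and independence only needs this function to be nonzero.\<close>

lemma of_circle_nonzero [simp]: "of_circle z \<noteq> 0"
  using of_circle[of z] by auto

lemma inv_rho: "inv (rho l g) = rho (- l) g"
proof (rule inv_equality)
  show "rho (- l) g (rho l g v) = v" "rho l g (rho (- l) g v) = v" for v
    by (simp_all add: rho_def power_int_minus)
qed

lemma hom_of_matrix_const: "hom_of_matrix (\<chi> i j. a) v = a * v"
  by (simp add: hom_of_matrix_def matrix_vector_mult_def)

lemma linear_complexD:
  assumes "Vector_Spaces.linear (*) (*) f"
  shows "f c = c * f (1 :: complex)"
proof -
  have "f (c * 1) = c * f 1"
    using assms by (simp only: Vector_Spaces.linear_def module_hom_def module_hom_axioms_def)
  then show ?thesis by simp
qed

text \<open>The action of the circle on itself is transitive, so a steerable kernel is determined by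
  its value at 1, a linear endomorphism of the complex numbers and hence a scalar.\<close>

lemma steerable_iff: "steerable l J K \<longleftrightarrow> (\<exists>c. \<forall>z v. K z v = c * (Y (l - J) z * v))"
proof
  assume K: "steerable l J K"
  have "K z v = K 1 1 * (Y (l - J) z * v)" for z v
  proof -
    \<comment> \<open>Here \<open>z\<close> plays the group element that moves the base point 1 to
      \<open>z\<close>.\<close>
    have "K (z * 1) v = (rho J z \<circ> K 1 \<circ> inv (rho l z)) v"
      using K unfolding steerable_def by metis
    also have "\<dots> = of_circle z powi J * K 1 (of_circle z powi (- l) * v)"
      by (simp add: inv_rho rho_def)
    also have "\<dots> = of_circle z powi J * (of_circle z powi (- l) * v * K 1 1)"
      using K by (subst linear_complexD) (simp_all add: steerable_def)
    also have "\<dots> = K 1 1 * (Y (l - J) z * v)"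
      \<comment> \<open>The exponents add up to \<open>J - l = - (l - J)\<close>, the one in
        \<open>Y (l - J)\<close>.\<close>
      by (simp add: Y_def power_int_diff power_int_minus field_simps)
    finally show ?thesis by simp
  qed
  then show "\<exists>c. \<forall>z v. K z v = c * (Y (l - J) z * v)" by blast
next
  assume "\<exists>c. \<forall>z v. K z v = c * (Y (l - J) z * v)"
  then obtain c where K: "\<And>z v. K z v = c * (Y (l - J) z * v)" by blast
  have "Vector_Spaces.linear (*) (*) (K z)" for z
    by unfold_locales (simp_all add: K algebra_simps)
  moreover have "K (g * z) = rho J g \<circ> K z \<circ> inv (rho l g)" for g z
    by (simp add: fun_eq_iff inv_rho rho_def K Y_def times_circle.rep_eq power_int_mult_distrib
        power_int_diff power_int_minus field_simps)
  ultimately show "steerable l J K" by (simp add: steerable_def)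
qed

theorem mainTheorem4:
  fixes l J :: int
  shows "kernel.independent {\<lambda>z. hom_of_matrix (\<chi> i j. Y (l - J) z)} \<and>
         kernel.span {\<lambda>z. hom_of_matrix (\<chi> i j. Y (l - J) z)} = steerable_kernels l J"
proof
  let ?B = "\<lambda>z. hom_of_matrix (\<chi> i j. Y (l - J) z)"
  \<comment> \<open>At the base point \<open>Y (l - J)\<close> equals 1, whatever \<open>l\<close>
    and \<open>J\<close> are.\<close>
  have "?B 1 1 \<noteq> 0"
    by (simp add: hom_of_matrix_const Y_def)
  then have "?B \<noteq> 0"
    by (metis zero_fun_apply)
  then show "kernel.independent {?B}"
    by simp
  show "kernel.span {?B} = steerable_kernels l J"
    \<comment> \<open>The span of one vector is the set of its multiples, which is the existential
      form in \<open>steerable_iff\<close>.\<close>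
    by (auto simp: kernel.span_singleton steerable_kernels_def steerable_iff kernel_scale_def
        hom_of_matrix_const fun_eq_iff image_iff)
qed

end
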